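(* Let $S\neq\mathbb{N}$ be a numerical semigroup with standard canonical ideal $K$, let $b\in S$ be an odd integer and let $I=S-\langle K\rangle$. The numerical duplication $T=S\Join^b I$ is GAS if and only if $S$ is GAS.
   Context: A numerical semigroup is a submonoid $S$ of $(\mathbb{N},+)$ (with $0\in\mathbb{N}$) such that $\mathbb{N}\setminus S$ is finite. It has a unique minimal system of generators, whose elements are its minimal generators. For a numerical semigroup $S$: $F(S)=\max(\mathbb{Z}\setminus S)$, $M(S)=S\setminus\{0\}$, the standard canonical ideal is $K(S)=\{x\in\mathbb{N}\mid F(S)-x\notin S\}$, and $K=K(S)$; $\langle K\rangle$ is the numerical semigroup generated by $K$. For sets $X,Y\subseteq\mathbb{Z}$, $X-Y=\{z\in\mathbb{Z}\mid z+Y\subseteq X\}$; $2K=K+K$. $PF(S)=(S-M(S))\setminus S$. An ideal of $S$ is a nonempty subset $I\subseteq S$ with $I+S\subseteq I$ ($S-\langle K\rangle$ is an ideal of $S$). For an ideal $I$ of $S$ and an odd integer $b\in S$, the numerical duplication is the numerical semigroup $S\Join^b I=\{2s\mid s\in S\}\cup\{2i+b\mid i\in I\}$. $S$ is GAS if either $2K=K$ or $2K\setminus K=\{F(S)-x_1,\dots,F(S)-x_r,F(S)\}$ for some $r\ge 0$ and some minimal generators $x_1,\dots,x_r$ of $S$ such that $x_i-x_j\notin PF(S)$ for every $i,j$; the same definition applies to $T$ with $K(T)$, $F(T)$, $PF(T)$. *)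

theory Defs
  imports Complex_Main "HOL-Library.Set_Algebras"
begin

text \<open>
  Subsets of the natural numbers are represented as integer sets contained in \<open>\<nat>\<close>, because
  Frobenius numbers, pseudo-Frobenius numbers and colon sets live in the integers.
  Between sets, \<open>X + Y\<close> is the Minkowski sum and \<open>z +o Y\<close> the translate, both from
  \<open>Set_Algebras\<close>, whereas \<open>X - Y\<close> is the set-theoretic difference.
\<close>

definition add_submonoid :: "int set \<Rightarrow> bool" where
  "add_submonoid S \<longleftrightarrow> 0 \<in> S \<and> (\<forall>x\<in>S. \<forall>y\<in>S. x + y \<in> S)"

definition numerical_semigroup :: "int set \<Rightarrow> bool" where
  "numerical_semigroup S \<longleftrightarrow> S \<subseteq> \<nat> \<and> add_submonoid S \<and> finite (\<nat> - S)"

definition generated :: "int set \<Rightarrow> int set" where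
  "generated X = add_submonoid hull X"

definition minimal_generating_system :: "int set \<Rightarrow> int set \<Rightarrow> bool" where
  "minimal_generating_system S G \<longleftrightarrow> generated G = S \<and> (\<forall>H. H \<subset> G \<longrightarrow> generated H \<noteq> S)"

text \<open>Well defined for numerical semigroups by \<open>ex1_minimal_generating_system\<close> below.\<close>

definition minimal_generators :: "int set \<Rightarrow> int set" where
  "minimal_generators S = (THE G. minimal_generating_system S G)"

text \<open>
  The complement of a numerical semigroup in the integers is infinite but bounded above, so its
  maximum is taken with \<open>Greatest\<close> (\<open>Max\<close> is only meaningful for finite sets).
\<close>

definition frobenius :: "int set \<Rightarrow> int" where
  "frobenius S = (GREATEST z. z \<notin> S)"

definition max_ideal :: "int set \<Rightarrow> int set" where
  "max_ideal S = S - {0}"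

definition canonical_ideal :: "int set \<Rightarrow> int set" where
  "canonical_ideal S = {x \<in> \<nat>. frobenius S - x \<notin> S}"

text \<open>The colon set, written \<open>X - Y\<close> in the semigroup literature.\<close>

definition colon :: "int set \<Rightarrow> int set \<Rightarrow> int set" where
  "colon X Y = {z. z +o Y \<subseteq> X}"

definition PF :: "int set \<Rightarrow> int set" where
  "PF S = colon S (max_ideal S) - S"

definition numerical_duplication :: "int set \<Rightarrow> int \<Rightarrow> int set \<Rightarrow> int set" where
  "numerical_duplication S b I = {2 * s | s. s \<in> S} \<union> {2 * i + b | i. i \<in> I}"

definition GAS :: "int set \<Rightarrow> bool" where
  "GAS S \<longleftrightarrow>
     (let K = canonical_ideal S; F = frobenius S in
        K + K = K \<or>
        (\<exists>(r::nat) x. (\<forall>i<r. x i \<in> minimal_generators S) \<and>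
           (\<forall>i<r. \<forall>j<r. x i - x j \<notin> PF S) \<and>
           (K + K) - K = {F - x i | i. i < r} \<union> {F}))"

lemma add_submonoid_generated: "add_submonoid (generated X)"
  unfolding generated_def by (rule hull_in) (auto simp: add_submonoid_def)

lemma generated_superset: "X \<subseteq> generated X"
  unfolding generated_def by (rule hull_subset)

lemma generated_least: "X \<subseteq> M \<Longrightarrow> add_submonoid M \<Longrightarrow> generated X \<subseteq> M"
  unfolding generated_def by (rule hull_minimal)

lemma ex1_minimal_generating_system:
  assumes S: "numerical_semigroup S"
  shows "\<exists>!G. minimal_generating_system S G"
proof -
  define A where "A = {x \<in> S. x \<noteq> 0 \<and> (\<forall>y\<in>S - {0}. \<forall>z\<in>S - {0}. x \<noteq> y + z)}"
  have nonneg: "x \<ge> 0" if "x \<in> S" for x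
    using S that by (auto simp: numerical_semigroup_def Nats_altdef2)
  have sub: "add_submonoid S"
    using S by (simp add: numerical_semigroup_def)
  have necessary: "A \<subseteq> H" if H: "generated H = S" for H
  proof
    fix a assume a: "a \<in> A"
    show "a \<in> H"
    proof (rule ccontr)
      assume "a \<notin> H"
      then have "H \<subseteq> S - {a}"
        using generated_superset[of H] H by auto
      moreover have "add_submonoid (S - {a})"
        unfolding add_submonoid_def
      proof (intro conjI ballI)
        show "0 \<in> S - {a}" using a sub by (auto simp: A_def add_submonoid_def)
        show "y + z \<in> S - {a}" if yz: "y \<in> S - {a}" "z \<in> S - {a}" for y z
        proof (cases "y = 0 \<or> z = 0")
          case True
          then show ?thesis using yz by auto
        next
          case False
          then have "a \<noteq> y + z" using a yz by (auto simp: A_def)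
          then show ?thesis using yz sub by (auto simp: add_submonoid_def)
        qed
      qed
      ultimately have "S \<subseteq> S - {a}"
        using generated_least[of H "S - {a}"] H by simp
      then show False using a by (auto simp: A_def)
    qed
  qed
  have "x \<in> S \<Longrightarrow> x \<in> generated A" for x
  proof (induction "nat x" arbitrary: x rule: less_induct)
    case less
    consider "x = 0" | "x \<in> A" | y z where "y \<in> S - {0}" "z \<in> S - {0}" "x = y + z"
      using less.prems unfolding A_def by blast
    then show ?case
    proof cases
      case 1
      then show ?thesis
        using add_submonoid_generated[of A] by (simp add: add_submonoid_def)
    next
      case 2
      then show ?thesis using generated_superset[of A] by auto
    next
      case 3
      then have "y > 0" "z > 0" using nonneg[of y] nonneg[of z] by auto
      then have "y \<in> generated A" "z \<in> generated A"
        using less.hyps[of y] less.hyps[of z] 3 by auto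
      then show ?thesis
        using 3 add_submonoid_generated[of A] by (simp add: add_submonoid_def)
    qed
  qed
  then have generates: "generated A = S"
    using generated_least[of A S] sub by (auto simp: A_def)
  show ?thesis
  proof (rule ex1I[of _ A])
    show "minimal_generating_system S A"
      using generates necessary by (auto simp: minimal_generating_system_def)
    show "G = A" if "minimal_generating_system S G" for G
      using that generates necessary[of G]
      by (auto simp: minimal_generating_system_def psubset_eq)
  qed
qed

end

theory Submission
  imports Defs
begin

text \<open>
  Write \<open>F\<close> for the Frobenius number, \<open>K\<close> for the standard canonical ideal and \<open>B = \<langle>K\<rangle>\<close> for the
  semigroup it generates. Reflection \<open>z \<mapsto> F - z\<close> exchanges \<open>K\<close> with the complement of \<open>S\<close>, so a
  point of a set \<open>L\<close> lies outside \<open>K\<close> exactly when it is \<open>F - x\<close> with \<open>x \<in> S\<close>. Hence \<open>S\<close> is GAS if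
  and only if all nonzero \<open>x \<in> S\<close> with \<open>F - x \<in> 2K\<close> are minimal generators with no difference in
  \<open>PF(S)\<close>. This is the condition \<open>gas_on S L\<close> for \<open>L = 2K\<close>, and it makes sense for every set \<open>L\<close>.

  The same reflection also gives \<open>z \<in> I \<longleftrightarrow> F - z \<notin> B\<close> for the ideal \<open>I = S - B\<close>. From this, the even
  and odd parts of everything attached to \<open>T = 2S \<union> (2I + b)\<close> can be read off: \<open>F(T) = 2F + b\<close>,
  \<open>K(T) = 2B \<union> (2K + b)\<close>, \<open>2K(T) = 2B \<union> (2B + b)\<close>, and the even elements of \<open>PF(T)\<close> are the doubles
  of \<open>PF(S) \<inter> B\<close>. The doubled elements of \<open>S\<close> that matter are irreducible in \<open>T\<close> exactly when they
  come from minimal generators of \<open>S\<close>, and the extra membership in \<open>B\<close> is automatic for the differences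
  in question. Therefore \<open>T\<close> is GAS if and only if \<open>gas_on S B\<close>.

  It remains to compare \<open>B\<close> with \<open>2K\<close>. They may differ even for a GAS semigroup: for
  \<open>S = {0, 14, 15} \<union> {18, 19, \<dots>}\<close> one has \<open>2K = \<nat> - {3}\<close> and \<open>3K = \<nat>\<close>. Nevertheless the condition
  spreads from \<open>2K\<close> to all multiples of \<open>K\<close>, by induction: lemma \<open>gas_on_add_K\<close> takes a
  violation in \<open>(n + 1)K\<close>, splits the offending element into three summands, and regroups these so as to
  exhibit a violation already in \<open>nK\<close>. As \<open>B\<close> is the increasing union of the multiples \<open>nK\<close>, this yields
  \<open>gas_on S B \<longleftrightarrow> gas_on S (2K)\<close> and the theorem.
\<close>

section \<open>Reflection in the Frobenius number and the GAS condition\<close>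

text \<open>
  Indexing by \<open>x \<in> S\<close> instead of by the points \<open>F - x\<close> of \<open>L\<close> outside \<open>K\<close> removes \<open>K\<close> from the
  condition; \<open>x = 0\<close> corresponds to the point \<open>F\<close>, on which GAS puts no restriction.
\<close>

definition gas_on :: "int set \<Rightarrow> int set \<Rightarrow> bool" where
  "gas_on S L \<longleftrightarrow>
     (\<forall>x\<in>S - {0}. frobenius S - x \<in> L \<longrightarrow> x \<in> minimal_generators S \<and>
        (\<forall>y\<in>S - {0}. frobenius S - y \<in> L \<longrightarrow> x - y \<notin> PF S))"

lemma gas_on_mono: "gas_on S L \<Longrightarrow> L' \<subseteq> L \<Longrightarrow> gas_on S L'"
  unfolding gas_on_def by blast

lemma mem_Nats_int: "(z :: int) \<in> \<nat> \<longleftrightarrow> 0 \<le> z"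
  by (metis Nats_cases of_nat_0_le_iff of_nat_in_Nats zero_le_imp_eq_int)

locale num_semigroup =
  fixes S :: "int set"
  assumes num_semigroup: "numerical_semigroup S"
begin

abbreviation "K \<equiv> canonical_ideal S"
abbreviation "F \<equiv> frobenius S"

lemma nonneg: "x \<in> S \<Longrightarrow> 0 \<le> x"
  using num_semigroup by (auto simp: numerical_semigroup_def mem_Nats_int)

lemma zero [simp]: "0 \<in> S"
  and add: "x \<in> S \<Longrightarrow> y \<in> S \<Longrightarrow> x + y \<in> S"
  using num_semigroup by (auto simp: numerical_semigroup_def add_submonoid_def)

lemma frobenius_eqI:
  assumes "f \<notin> S" "\<And>z. f < z \<Longrightarrow> z \<in> S"
  shows "F = f"
  unfolding frobenius_def using assms by (intro Greatest_equality) (auto simp: not_less[symmetric])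

lemma F_notin [simp]: "F \<notin> S" and above_F: "F < z \<Longrightarrow> z \<in> S"
proof -
  define G where "G = insert (-1) (\<nat> - S)"
  have fin: "finite G"
    using num_semigroup by (simp add: G_def numerical_semigroup_def)
  have "Max G \<in> G"
    by (rule Max_in[OF fin]) (simp add: G_def)
  then have gap: "Max G \<notin> S"
    using nonneg[of "-1"] by (auto simp: G_def)
  have above: "z \<in> S" if "Max G < z" for z
  proof (rule ccontr)
    assume "z \<notin> S"
    moreover have "-1 \<le> Max G"
      by (rule Max_ge[OF fin]) (simp add: G_def)
    ultimately have "z \<in> G"
      using that by (auto simp: G_def mem_Nats_int)
    then show False
      using Max_ge[OF fin] that by fastforce
  qed
  have "F = Max G"
    by (rule frobenius_eqI[OF gap above])
  then show "F \<notin> S" and "F < z \<Longrightarrow> z \<in> S"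
    using gap above by auto
qed

text \<open>
  Nonnegativity of the elements of \<open>K\<close> comes for free, because everything above \<open>F\<close> lies in \<open>S\<close>.
\<close>

lemma mem_K: "x \<in> K \<longleftrightarrow> F - x \<notin> S"
  using above_F[of "F - x"] by (cases "0 \<le> x") (auto simp: canonical_ideal_def mem_Nats_int)

lemma reflect_mem_K: "F - z \<in> K \<longleftrightarrow> z \<notin> S"
  by (simp add: mem_K)

lemma K_nonneg: "x \<in> K \<Longrightarrow> 0 \<le> x"
  by (auto simp: canonical_ideal_def mem_Nats_int)

lemma zero_K [simp]: "0 \<in> K"
  by (simp add: mem_K)

lemma K_add_S: "x \<in> K \<Longrightarrow> s \<in> S \<Longrightarrow> x + s \<in> K"
  using add[of "F - (x + s)" s] by (auto simp: mem_K algebra_simps)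

lemma S_subset_K: "s \<in> S \<Longrightarrow> s \<in> K"
  using K_add_S[of 0 s] by simp

text \<open>
  An irreducible \<open>a\<close> lies in every generating set, since \<open>S - {a}\<close> is still a submonoid; conversely the
  irreducibles generate \<open>S\<close>, as the summands of a proper decomposition are smaller. So they form
  the unique minimal generating system.
\<close>

lemma minimal_generators_iff:
  "x \<in> minimal_generators S \<longleftrightarrow>
     x \<in> S - {0} \<and> (\<forall>y\<in>S - {0}. \<forall>z\<in>S - {0}. x \<noteq> y + z)"
proof -
  define A where "A = {x \<in> S - {0}. \<forall>y\<in>S - {0}. \<forall>z\<in>S - {0}. x \<noteq> y + z}"
  define G where "G = minimal_generators S"
  have "minimal_generating_system S G"
    unfolding G_def minimal_generators_def
    by (rule theI') (rule ex1_minimal_generating_system[OF num_semigroup])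
  then have G: "generated G = S" and G_min: "\<And>H. H \<subset> G \<Longrightarrow> generated H \<noteq> S"
    by (auto simp: minimal_generating_system_def)
  have "A \<subseteq> G"
  proof
    fix a assume a: "a \<in> A"
    show "a \<in> G"
    proof (rule ccontr)
      assume "a \<notin> G"
      then have "G \<subseteq> S - {a}"
        using generated_superset[of G] G by auto
      moreover have "add_submonoid (S - {a})"
        unfolding add_submonoid_def
      proof (intro conjI ballI)
        show "0 \<in> S - {a}"
          using a by (auto simp: A_def)
        show "y + z \<in> S - {a}" if "y \<in> S - {a}" "z \<in> S - {a}" for y z
          using that a add[of y z] by (cases "y = 0 \<or> z = 0") (auto simp: A_def)
      qed
      ultimately have "S \<subseteq> S - {a}"
        using generated_least G by metis
      then show False
        using a by (auto simp: A_def)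
    qed
  qed
  moreover have "generated A = S"
  proof
    show "generated A \<subseteq> S"
      using num_semigroup by (intro generated_least) (auto simp: A_def numerical_semigroup_def)
    have "x \<in> S \<Longrightarrow> x \<in> generated A" for x
    proof (induction "nat x" arbitrary: x rule: less_induct)
      case less
      consider "x = 0" | "x \<in> A" | y z where "y \<in> S - {0}" "z \<in> S - {0}" "x = y + z"
        using less.prems unfolding A_def by blast
      then show ?case
      proof cases
        case 3
        then have "0 < y" "0 < z"
          using nonneg[of y] nonneg[of z] by auto
        then have "y \<in> generated A" "z \<in> generated A"
          using less.hyps[of y] less.hyps[of z] 3 by auto
        then show ?thesis
          using 3 add_submonoid_generated[of A] by (simp add: add_submonoid_def)
      qed (use add_submonoid_generated[of A] generated_superset[of A] in
            \<open>auto simp: add_submonoid_def\<close>)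
    qed
    then show "S \<subseteq> generated A"
      by blast
  qed
  ultimately have "G = A"
    using G_min[of A] by blast
  then show ?thesis
    by (auto simp: G_def A_def)
qed

lemma PF_iff: "f \<in> PF S \<longleftrightarrow> f \<notin> S \<and> (\<forall>m\<in>S - {0}. f + m \<in> S)"
  by (auto simp: PF_def colon_def max_ideal_def elt_set_plus_def)

text \<open>
  If \<open>f + k\<close> were outside \<open>K\<close>, its reflection would be a nonzero element of \<open>S\<close>, which \<open>f\<close> translates
  into \<open>S\<close>; but the translate is the reflection of \<open>k\<close>. For \<open>k = 0\<close> this says that every
  pseudo-Frobenius number other than \<open>F\<close> lies in \<open>K\<close>.
\<close>

lemma PF_add_K:
  assumes f: "f \<in> PF S" and k: "k \<in> K" and ne: "f + k \<noteq> F"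
  shows "f + k \<in> K"
proof (rule ccontr)
  assume "f + k \<notin> K"
  then have "F - (f + k) \<in> S - {0}"
    using ne by (simp add: mem_K)
  then have "f + (F - (f + k)) \<in> S"
    using f unfolding PF_iff by blast
  then show False
    using k by (simp add: mem_K)
qed

text \<open>
  If \<open>2K = K\<close>, then no element of \<open>S\<close> has its reflection in \<open>2K\<close>, so the two alternatives
  in the definition of GAS merge into one condition.
\<close>

lemma GAS_iff: "GAS S \<longleftrightarrow> gas_on S (K + K)"
proof
  assume "GAS S"
  then consider "K + K = K"
    | r :: nat and x where "\<forall>i<r. x i \<in> minimal_generators S"
        "\<forall>i<r. \<forall>j<r. x i - x j \<notin> PF S"
        "(K + K) - K = {F - x i | i. i < r} \<union> {F}"
    unfolding GAS_def Let_def by blast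
  then show "gas_on S (K + K)"
  proof cases
    case 1
    then show ?thesis
      by (auto simp: gas_on_def mem_K)
  next
    case 2
    have "\<exists>i<r. s = x i" if "s \<in> S - {0}" "F - s \<in> K + K" for s
    proof -
      have "F - s \<in> (K + K) - K"
        using that by (simp add: mem_K)
      then show ?thesis
        using that unfolding 2(3) by auto
    qed
    then show ?thesis
      unfolding gas_on_def using 2(1,2) by metis
  qed
next
  assume gas: "gas_on S (K + K)"
  show "GAS S"
  proof (cases "K + K = K")
    case True
    then show ?thesis
      by (simp add: GAS_def)
  next
    case False
    define D where "D = {s \<in> S - {0}. F - s \<in> K + K}"
    have K2_nonneg: "0 \<le> z" if "z \<in> K + K" for z
      using that K_nonneg by (auto elim!: set_plus_elim)
    have "D \<subseteq> {0..F}"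
      using K2_nonneg nonneg by (fastforce simp: D_def)
    then have "finite D"
      by (rule finite_subset) simp
    then obtain x and r :: nat where x: "x ` {0..<r} = D"
      using ex_bij_betw_nat_finite[of D] by (auto simp: bij_betw_def)
    have "K \<subseteq> K + K"
      using set_plus_intro[of 0 K _ K] by auto
    with False obtain p q where pq: "p \<in> K" "q \<in> K" "p + q \<notin> K"
      by (auto elim!: set_plus_elim)
    \<comment> \<open>Adding to \<open>p + q\<close> its reflection, which lies in \<open>S\<close>, gives \<open>F\<close>, and \<open>K + K\<close> absorbs \<open>S\<close>.\<close>
    have "F \<in> K + K"
      using set_plus_intro[OF pq(1) K_add_S[OF pq(2), of "F - (p + q)"]] pq(3)
      by (simp add: mem_K)
    have "(K + K) - K = {F - s | s. s \<in> D} \<union> {F}"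
    proof (intro equalityI subsetI)
      fix z assume "z \<in> (K + K) - K"
      then have "z = F \<or> F - z \<in> D"
        by (auto simp: D_def mem_K)
      moreover have "z = F - (F - z)"
        by simp
      ultimately show "z \<in> {F - s | s. s \<in> D} \<union> {F}"
        by blast
    next
      fix z assume "z \<in> {F - s | s. s \<in> D} \<union> {F}"
      then show "z \<in> (K + K) - K"
        using \<open>F \<in> K + K\<close> by (auto simp: D_def mem_K)
    qed
    also have "{F - s | s. s \<in> D} = {F - s | s. s \<in> x ` {0..<r}}"
      by (simp only: x)
    also have "\<dots> = {F - x i | i. i < r}"
      by auto
    finally have "(K + K) - K = {F - x i | i. i < r} \<union> {F}" .
    moreover have "x i \<in> D" if "i < r" for i
      using that x by auto
    then have "\<forall>i<r. x i \<in> minimal_generators S"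
        "\<forall>i<r. \<forall>j<r. x i - x j \<notin> PF S"
      using gas by (auto simp: gas_on_def D_def)
    ultimately show ?thesis
      unfolding GAS_def Let_def by blast
  qed
qed

section \<open>Passing from one multiple of the canonical ideal to the next\<close>

text \<open>
  Here \<open>J\<close> stands for \<open>(n - 1)K\<close> and \<open>L = K + J\<close> for \<open>nK\<close>, where \<open>n \<ge> 2\<close>. An offending reflection in
  \<open>K + L\<close> is written as \<open>a + c + j\<close> with \<open>a, c \<in> K\<close> and \<open>j \<in> J\<close>. Any two of the three terms add up to
  an element of \<open>L\<close>, and a partial sum that happens to lie in \<open>K\<close> counts as a single summand. So either a
  regrouping puts the whole element in \<open>L\<close>, or the partial sums lie outside \<open>K\<close> and reflect to elements
  of \<open>S\<close> to which the hypothesis on \<open>L\<close> applies.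
\<close>

lemma gas_on_add_K:
  assumes KJ: "K \<subseteq> J" and J_nonneg: "\<And>j. j \<in> J \<Longrightarrow> 0 \<le> j"
    and gas: "gas_on S (K + J)"
  shows "gas_on S (K + (K + J))"
proof -
  define L where "L = K + J"
  have L: "k + j \<in> L" if "k \<in> K" "j \<in> J" for k j
    using that by (auto simp: L_def)
  have KK: "k + k' \<in> L" if "k \<in> K" "k' \<in> K" for k k'
    using that KJ by (auto intro: L)
  have gen: "x \<in> minimal_generators S" if "x \<in> S" "x \<noteq> 0" "F - x \<in> L" for x
    using that gas by (auto simp: gas_on_def L_def)
  have diff: "x - y \<notin> PF S"
    if "x \<in> S" "x \<noteq> 0" "F - x \<in> L" "y \<in> S" "y \<noteq> 0" "F - y \<in> L" for x y
    using that gas by (auto simp: gas_on_def L_def)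
  have irred: False
    if "x \<in> S" "x \<noteq> 0" "y \<in> S" "y \<noteq> 0" "F - (x + y) \<in> L" for x y
  proof -
    have "x + y \<in> S" "x + y \<noteq> 0"
      using that add nonneg[of x] nonneg[of y] by auto
    then have "x + y \<in> minimal_generators S"
      using gen that by simp
    then show False
      using that by (auto simp: minimal_generators_iff)
  qed
  \<comment> \<open>An element of \<open>K + L\<close> outside \<open>L\<close> is a sum of three terms, no two of which add up to an element
    of \<open>K\<close>; in terms of reflections, \<open>x + j\<close> and \<open>x + c\<close> lie in \<open>S\<close>.\<close>
  have three: "\<exists>a\<in>K. \<exists>c\<in>K. \<exists>j\<in>J. F - x = a + c + j \<and> c \<noteq> 0 \<and> x + j \<in> S \<and> x + c \<in> S"
    if "F - x \<in> K + L" "F - x \<notin> L" for x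
  proof -
    obtain a c j where acj: "a \<in> K" "c \<in> K" "j \<in> J" "F - x = a + c + j"
      using \<open>F - x \<in> K + L\<close> unfolding L_def by (auto elim!: set_plus_elim simp: add.assoc)
    have eq: "x + j = F - (a + c)" "x + c = F - (a + j)"
      using acj(4) by linarith+
    have "a + c \<notin> K" "a + j \<notin> K" "c \<noteq> 0"
      using acj that(2) L[of "a + c" j] KK[of "a + j" c] L[of a j] by (auto simp: algebra_simps)
    then have "x + j \<in> S" "x + c \<in> S"
      unfolding eq by (simp_all add: mem_K)
    then show ?thesis
      using acj \<open>c \<noteq> 0\<close> by blast
  qed
  \<comment> \<open>If \<open>x = s + t\<close>, then \<open>x + j\<close> and \<open>t\<close> both have their reflections in \<open>L\<close>. Their difference
    \<open>s + j\<close> is neither in \<open>S\<close> nor pseudo-Frobenius, and the witness \<open>m\<close> of the latter makes \<open>s + m\<close> a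
    reducible element with reflection in \<open>L\<close>.\<close>
  have gen': "x \<in> minimal_generators S" if x: "x \<in> S" "x \<noteq> 0" "F - x \<in> K + L" for x
  proof (cases "F - x \<in> L")
    case True
    then show ?thesis
      using x gen by blast
  next
    case False
    then obtain a c j where acj: "a \<in> K" "c \<in> K" "j \<in> J" "F - x = a + c + j"
      and xj: "x + j \<in> S"
      using three[OF x(3)] by blast
    have xjL: "F - (x + j) \<in> L"
      using KK[OF acj(1,2)] acj(4) by (simp add: algebra_simps)
    have False if st: "s \<in> S" "s \<noteq> 0" "t \<in> S" "t \<noteq> 0" "x = s + t" for s t
    proof -
      have pos: "0 < s" "0 < t" "0 \<le> j"
        using st nonneg[of s] nonneg[of t] J_nonneg[OF acj(3)] by auto
      have "s + j \<notin> S" "t + j \<notin> S"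
        using irred[of "s + j" t] irred[of "t + j" s] xjL st pos by (auto simp: algebra_simps)
      have eq: "F - (t + j) = s + a + c" "F - t = s + a + c + j"
        using acj(4) st(5) by linarith+
      have "s + a + c \<in> K"
        using \<open>t + j \<notin> S\<close> eq by (simp add: mem_K algebra_simps)
      then have "F - t \<in> L"
        using L[of "s + a + c" j] acj(3) eq by simp
      then have "x + j - t \<notin> PF S"
        using diff[of "x + j" t] xj xjL st pos by auto
      then have "s + j \<notin> PF S"
        using st(5) by (simp add: algebra_simps)
      then obtain m where m: "m \<in> S" "m \<noteq> 0" "s + j + m \<notin> S"
        using \<open>s + j \<notin> S\<close> by (auto simp: PF_iff)
      have "F - (s + j + m) \<in> K"
        unfolding reflect_mem_K by (rule m(3))
      then have "F - (s + m) \<in> L"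
        using L[of "F - (s + j + m)" j] acj(3) by (simp add: algebra_simps)
      then show False
        using irred[of s m] st m by blast
    qed
    then show ?thesis
      using x by (auto simp: minimal_generators_iff)
  qed
  \<comment> \<open>If \<open>f = y - x\<close> is pseudo-Frobenius, adding \<open>f\<close> to a \<open>K\<close>-summand of \<open>F - y\<close> stays in \<open>K\<close> by
    \<open>PF_add_K\<close>, so \<open>F - x\<close> has no more summands than \<open>F - y\<close>. A pair in \<open>S\<close> with the same
    difference \<open>f\<close> and with reflections already in \<open>L\<close> is then the contradiction to look for.\<close>
  have diff': "y - x \<notin> PF S"
    if y: "y \<in> S" "y \<noteq> 0" "F - y \<in> K + L" and x: "x \<in> S" "x \<noteq> 0" "F - x \<in> K + L" for x y
  proof
    assume f: "y - x \<in> PF S"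
    define f where "f = y - x"
    have f: "f \<in> PF S" and y_eq: "y = x + f"
      using f by (auto simp: f_def)
    have xpos: "0 < x"
      using x nonneg[of x] by auto
    have absorb: "f + k \<in> K" if "k \<in> K" "0 \<le> l" "F - y = k + l" for k l
    proof (rule PF_add_K[OF f that(1)])
      show "f + k \<noteq> F"
        using that y_eq xpos by linarith
    qed
    show False
    proof (cases "F - y \<in> L")
      case True
      then obtain k j where kj: "k \<in> K" "j \<in> J" "F - y = k + j"
        by (auto simp: L_def elim!: set_plus_elim)
      have "F - x = (f + k) + j"
        using kj(3) y_eq by linarith
      then have "F - x \<in> L"
        using L[of "f + k" j] absorb[of k j] kj J_nonneg by auto
      then show False
        using diff[of y x] True x y f by (simp add: f_def)
    next
      case False
      then obtain a c j where acj: "a \<in> K" "c \<in> K" "j \<in> J" "F - y = a + c + j" "c \<noteq> 0"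
        and yj: "y + j \<in> S" and yc: "y + c \<in> S"
        using three[OF y(3)] by blast
      have pos: "0 \<le> a" "0 < c" "0 \<le> j" "0 < y"
        using acj K_nonneg[of a] K_nonneg[of c] J_nonneg[of j] y nonneg[of y] by auto
      have fa: "f + a \<in> K" and fc: "f + c \<in> K"
        using absorb[of a "c + j"] absorb[of c "a + j"] acj pos by auto
      have "f \<in> K"
        using absorb[of 0 "F - y"] acj pos by simp
      then have fpos: "0 \<le> f"
        by (rule K_nonneg)
      have eq: "F - (y + j) = a + c" "F - (x + j) = f + a + c" "F - (y + c) = a + j"
          "F - x = (f + a + c) + j"
        using acj(4) y_eq by linarith+
      have "x + j \<notin> S"
      proof
        assume "x + j \<in> S"
        then have "(y + j) - (x + j) \<notin> PF S"
          using diff[of "y + j" "x + j"] yj pos xpos eq KK[OF acj(1,2)] KK[OF fa acj(2)] by auto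
        then show False
          using f by (simp add: f_def)
      qed
      then have "f + a + c \<in> K"
        by (simp add: eq(2)[symmetric] mem_K)
      then have xL: "F - x \<in> L"
        using L[of "f + a + c" j] acj(3) eq(4) by simp
      have ycL: "F - (y + c) \<in> L"
        using L[OF acj(1,3)] eq(3) by simp
      \<comment> \<open>The hypothesis applies to \<open>y + c\<close> and \<open>x\<close>, whose difference is \<open>f + c\<close>; it provides the \<open>m\<close> below.\<close>
      have "(y + c) - x \<notin> PF S"
        using diff[OF yc _ ycL x(1,2) xL] pos by simp
      then have "f + c \<notin> PF S"
        using y_eq by (simp add: algebra_simps)
      moreover have "f + c \<notin> S"
        using irred[of x "f + c"] x ycL pos fpos y_eq by (auto simp: algebra_simps)
      ultimately obtain m where m: "m \<in> S" "m \<noteq> 0" "f + c + m \<notin> S"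
        by (auto simp: PF_iff)
      define k where "k = F - (f + c + m)"
      have "k \<in> K"
        unfolding k_def reflect_mem_K by (rule m(3))
      \<comment> \<open>The reflections of \<open>m\<close> and \<open>f + m\<close> are \<open>k + (f + c)\<close> and \<open>k + c\<close>, both in \<open>2K \<subseteq> L\<close>: this is the
        pair with difference \<open>f\<close>.\<close>
      have "F - m \<in> L" "F - (f + m) \<in> L"
        using KK[OF \<open>k \<in> K\<close> fc] KK[OF \<open>k \<in> K\<close> acj(2)] by (auto simp: k_def algebra_simps)
      moreover have "f + m \<in> S" "f + m \<noteq> 0"
        using f m fpos nonneg[of m] by (auto simp: PF_iff)
      ultimately have "f + m - m \<notin> PF S"
        using diff m by blast
      then show False
        using f by simp
    qed
  qed
  show ?thesis
    unfolding gas_on_def L_def[symmetric] using gen' diff' by blast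
qed

section \<open>The semigroup generated by the canonical ideal\<close>

abbreviation "B \<equiv> generated K"

lemma K_subset_B: "k \<in> K \<Longrightarrow> k \<in> B"
  using generated_superset by blast

lemma B_add: "u \<in> B \<Longrightarrow> v \<in> B \<Longrightarrow> u + v \<in> B"
  using add_submonoid_generated[of K] by (simp add: add_submonoid_def)

lemma S_subset_B: "s \<in> S \<Longrightarrow> s \<in> B"
  by (intro K_subset_B S_subset_K)

lemma B_nonneg: "u \<in> B \<Longrightarrow> 0 \<le> u"
  using generated_least[of K "{0..}"] K_nonneg by (auto simp: add_submonoid_def)

text \<open>
  The iterate with exponent \<open>n\<close> is \<open>(n + 1)K\<close>, because the iteration starts from \<open>K\<close>.
\<close>

lemma B_subset_multiples: "B \<subseteq> (\<Union>n. (((+) K) ^^ n) K)" (is "_ \<subseteq> (\<Union>n. ?L n)")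
proof (rule generated_least)
  show "K \<subseteq> (\<Union>n. ?L n)"
    by (metis UN_upper UNIV_I funpow_0)
  have sum: "x \<in> ?L m \<Longrightarrow> y \<in> ?L n \<Longrightarrow> x + y \<in> ?L (Suc (m + n))" for x y m n
  proof (induction m arbitrary: x)
    case 0
    then show ?case
      by auto
  next
    case (Suc m)
    then obtain k x' where "k \<in> K" "x' \<in> ?L m" "x = k + x'"
      by (auto elim!: set_plus_elim)
    then show ?case
      using set_plus_intro[OF \<open>k \<in> K\<close> Suc.IH[OF \<open>x' \<in> ?L m\<close> Suc.prems(2)]]
      by (simp add: add.assoc)
  qed
  have "0 \<in> ?L 0"
    by simp
  then show "add_submonoid (\<Union>n. ?L n)"
    unfolding add_submonoid_def using sum by blast
qed

text \<open>
  The condition involves only two elements of \<open>B\<close> at a time, and these lie in a common multiple of \<open>K\<close>;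
  so it suffices to have it on each multiple.
\<close>

lemma gas_on_B_iff: "gas_on S B \<longleftrightarrow> gas_on S (K + K)"
proof
  assume "gas_on S B"
  then show "gas_on S (K + K)"
    by (rule gas_on_mono) (auto elim!: set_plus_elim intro: B_add K_subset_B)
next
  assume gas: "gas_on S (K + K)"
  define L where "L n = (((+) K) ^^ n) K" for n
  have L_Suc: "L (Suc n) = K + L n" for n
    by (simp add: L_def)
  have L_mono: "L n \<subseteq> L (Suc n)" for n
    using set_plus_intro[of 0 K _ "L n"] by (auto simp: L_Suc)
  then have chain: "m \<le> n \<Longrightarrow> L m \<subseteq> L n" for m n
    by (rule lift_Suc_mono_le)
  have L_nonneg: "z \<in> L n \<Longrightarrow> 0 \<le> z" for z n
    by (induction n arbitrary: z) (auto simp: L_def K_nonneg elim!: set_plus_elim)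
  have step: "gas_on S (L (Suc n))" for n
  proof (induction n)
    case 0
    then show ?case
      using gas by (simp add: L_def)
  next
    case (Suc n)
    have "K \<subseteq> L n"
      using chain[of 0 n] by (simp add: L_def)
    then show ?case
      using gas_on_add_K[of "L n"] L_nonneg Suc by (simp add: L_Suc)
  qed
  have "\<exists>n. {u, v} \<subseteq> L (Suc n)" if "u \<in> B" "v \<in> B" for u v
  proof -
    have "u \<in> (\<Union>n. L n)" "v \<in> (\<Union>n. L n)"
      using that B_subset_multiples by (auto simp: L_def)
    then obtain m n where "u \<in> L m" "v \<in> L n"
      by blast
    then show ?thesis
      using chain[of m "Suc (m + n)"] chain[of n "Suc (m + n)"] by auto
  qed
  then show "gas_on S B"
    using step unfolding gas_on_def by (metis insert_subset)
qed

text \<open>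
  This is the duality \<open>S - B = K - B\<close>: if \<open>z + u \<notin> S\<close> for some \<open>u \<in> B\<close>, then the reflection of \<open>z + u\<close>
  is in \<open>K\<close>, and adding \<open>u\<close> back puts \<open>F - z\<close> in \<open>B\<close>.
\<close>

lemma mem_colon_B: "z \<in> colon S B \<longleftrightarrow> F - z \<notin> B"
proof
  assume "z \<in> colon S B"
  then have "z + (F - z) \<in> S" if "F - z \<in> B"
    using that unfolding colon_def elt_set_plus_def by blast
  then show "F - z \<notin> B"
    by auto
next
  assume z: "F - z \<notin> B"
  have "z + u \<in> S" if u: "u \<in> B" for u
  proof (rule ccontr)
    assume "z + u \<notin> S"
    then have "F - (z + u) \<in> B"
      by (intro K_subset_B) (simp add: mem_K)
    then show False
      using B_add[OF u, of "F - (z + u)"] z by simp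
  qed
  then show "z \<in> colon S B"
    by (auto simp: colon_def elt_set_plus_def)
qed

end

section \<open>The numerical duplication\<close>

locale duplication = num_semigroup +
  fixes b :: int
  assumes b_mem: "b \<in> S" and b_odd: "odd b"
begin

abbreviation "I \<equiv> colon S B"
abbreviation "T \<equiv> numerical_duplication S b I"

lemma mem_I: "z \<in> I \<longleftrightarrow> F - z \<notin> B"
  by (rule mem_colon_B)

lemma I_subset_S:
  assumes z: "z \<in> I"
  shows "z \<in> S"
  using z mem_K[of "F - z"] K_subset_B by (auto simp: mem_I)

lemma b_pos: "0 < b"
  using b_mem b_odd nonneg[of b] by (cases "b = 0") auto

lemma T_even: "2 * z \<in> T \<longleftrightarrow> z \<in> S"
  using b_odd by (auto simp: numerical_duplication_def) presburger

lemma T_odd: "2 * z + b \<in> T \<longleftrightarrow> z \<in> I"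
  using b_odd by (auto simp: numerical_duplication_def) presburger

lemma parity: "(\<exists>y. z = 2 * y) \<or> (\<exists>y. z = 2 * y + b)"
  using b_odd by presburger

lemma even_sum_cases:
  assumes "2 * z = u + v"
  obtains p q where "u = 2 * p" "v = 2 * q" "z = p + q"
    | p q where "u = 2 * p + b" "v = 2 * q + b" "z = (p + q) + b"
proof -
  have even: "even (u + v)"
    by (simp add: assms[symmetric])
  consider p where "u = 2 * p" | p where "u = 2 * p + b"
    using parity by blast
  then show thesis
  proof cases
    case 1
    with even obtain q where "v = 2 * q"
      by auto
    then show thesis
      using 1 assms by (intro that(1)) auto
  next
    case 2
    with even b_odd have "odd v"
      by auto
    then obtain q where "v = 2 * q + b"
      using parity[of v] by auto
    then show thesis
      using 2 assms by (intro that(2)) auto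
  qed
qed

lemma T_nonneg:
  assumes x: "x \<in> T"
  shows "0 \<le> x"
  using x nonneg b_pos I_subset_S by (fastforce simp: numerical_duplication_def)

lemma T_add:
  assumes xy: "x \<in> T" "y \<in> T"
  shows "x + y \<in> T"
proof -
  have I_add: "i + s \<in> I" if "i \<in> I" "s \<in> S" for i s
    using that B_add[OF _ S_subset_B, of "F - (i + s)" s] by (auto simp: mem_I)
  consider s t where "x = 2 * s" "y = 2 * t" "x + y = 2 * (s + t)"
    | s i where "x = 2 * s" "y = 2 * i + b" "x + y = 2 * (i + s) + b"
    | i s where "x = 2 * i + b" "y = 2 * s" "x + y = 2 * (i + s) + b"
    | i j where "x = 2 * i + b" "y = 2 * j + b" "x + y = 2 * (i + j + b)"
    using parity[of x] parity[of y] by force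
  then show ?thesis
  proof cases
    case 1
    then show ?thesis
      using xy add by (simp only: T_even)
  next
    case 2
    then show ?thesis
      using xy I_add by (simp only: T_even T_odd)
  next
    case 3
    then show ?thesis
      using xy I_add by (simp only: T_even T_odd)
  next
    case 4
    then show ?thesis
      using xy I_subset_S add b_mem by (simp only: T_even T_odd)
  qed
qed

lemma T_above:
  assumes z: "2 * F + b < z"
  shows "z \<in> T"
proof -
  consider y where "z = 2 * y" | y where "z = 2 * y + b"
    using parity by blast
  then show ?thesis
  proof cases
    case 1
    then show ?thesis
      using z b_pos by (simp add: T_even above_F)
  next
    case 2
    then show ?thesis
      using z B_nonneg[of "F - y"] by (auto simp: T_odd mem_I)
  qed
qed

sublocale T: num_semigroup T
proof
  have "finite (\<nat> - T)"
  proof (rule finite_subset)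
    show "\<nat> - T \<subseteq> {0..2 * F + b}"
      using T_above by (meson DiffE atLeastAtMost_iff mem_Nats_int not_less subsetI)
  qed simp
  moreover have "T \<subseteq> \<nat>"
    using T_nonneg by (auto simp only: mem_Nats_int)
  moreover have "add_submonoid T"
    using T_add T_even[of 0] by (simp add: add_submonoid_def)
  ultimately show "numerical_semigroup T"
    by (simp add: numerical_semigroup_def)
qed

lemma F_notin_I: "F \<notin> I"
  using S_subset_B[of 0] by (simp add: mem_I)

lemma T_frobenius: "T.F = 2 * F + b"
  using F_notin_I T_above by (intro T.frobenius_eqI) (auto simp: T_odd)

text \<open>
  The reflection in \<open>2F + b\<close> changes parity, so the even part of \<open>K(T)\<close> is governed by \<open>I\<close>, whose
  reflected complement is \<open>B\<close>, and the odd part by \<open>S\<close>, whose reflected complement is \<open>K\<close>.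
\<close>

lemma T_K_even: "2 * z \<in> T.K \<longleftrightarrow> z \<in> B"
  using T_odd[of "F - z"] by (simp add: T.mem_K T_frobenius mem_I algebra_simps)

lemma T_K_odd: "2 * z + b \<in> T.K \<longleftrightarrow> z \<in> K"
  using T_even[of "F - z"] by (simp add: T.mem_K T_frobenius mem_K algebra_simps)

lemma T_2K_odd: "2 * z + b \<in> T.K + T.K \<longleftrightarrow> z \<in> B"
proof
  have pq: "p + q \<in> B" if "2 * p \<in> T.K" "2 * q + b \<in> T.K" for p q
    using that B_add K_subset_B by (simp add: T_K_even T_K_odd)
  assume "2 * z + b \<in> T.K + T.K"
  then obtain u v where uv: "u \<in> T.K" "v \<in> T.K" "2 * z + b = u + v"
    by (auto elim!: set_plus_elim)
  have "odd (u + v)"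
    using b_odd by (simp add: uv(3)[symmetric])
  then consider p q where "u = 2 * p" "v = 2 * q + b" | p q where "u = 2 * q + b" "v = 2 * p"
    using parity[of u] parity[of v] b_odd by auto
  then show "z \<in> B"
  proof cases
    case 1
    then have "z = p + q"
      using uv(3) by simp
    then show ?thesis
      using pq uv 1 by blast
  next
    case 2
    then have "z = p + q"
      using uv(3) by simp
    then show ?thesis
      using pq uv 2 by blast
  qed
next
  assume "z \<in> B"
  then show "2 * z + b \<in> T.K + T.K"
    using set_plus_intro[of "2 * z" T.K b T.K] T_K_odd[of 0] by (simp add: T_K_even)
qed

lemma T_2K_even:
  assumes even: "2 * z \<in> T.K + T.K"
  shows "z \<in> B"
proof -
  obtain u v where uv: "u \<in> T.K" "v \<in> T.K" "2 * z = u + v"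
    using even by (auto elim!: set_plus_elim)
  from uv(3) show ?thesis
  proof (cases rule: even_sum_cases)
    case (1 p q)
    then show ?thesis
      using uv B_add T_K_even by metis
  next
    case (2 p q)
    then show ?thesis
      using uv B_add K_subset_B S_subset_B[OF b_mem] T_K_odd by metis
  qed
qed

text \<open>
  A decomposition of \<open>2s\<close> in \<open>T\<close> into odd summands reads \<open>s = p + q + b\<close> with \<open>p, q \<in> I\<close>; for a minimal
  generator \<open>s\<close> this forces \<open>p = q = 0\<close>. But \<open>0 \<in> I\<close> means \<open>F \<notin> B\<close>, whereas \<open>F = (F - s) + s\<close> is in \<open>B\<close>.
\<close>

lemma T_minimal_generators:
  assumes s: "s \<in> S" "s \<noteq> 0" "F - s \<in> B"
  shows "2 * s \<in> minimal_generators T \<longleftrightarrow> s \<in> minimal_generators S"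
proof
  assume 2: "2 * s \<in> minimal_generators T"
  have "s \<noteq> y + z" if "y \<in> S - {0}" "z \<in> S - {0}" for y z
  proof
    assume "s = y + z"
    then have "2 * s = 2 * y + 2 * z"
      by simp
    then show False
      using 2 that unfolding T.minimal_generators_iff by (force simp: T_even)
  qed
  then show "s \<in> minimal_generators S"
    using s by (simp add: minimal_generators_iff)
next
  assume s_gen: "s \<in> minimal_generators S"
  have irred: False if "y \<in> S" "z \<in> S" "y \<noteq> 0" "z \<noteq> 0" "s = y + z" for y z
    using s_gen that by (auto simp: minimal_generators_iff)
  have "2 * s \<noteq> u + v" if uv: "u \<in> T - {0}" "v \<in> T - {0}" for u v
  proof
    assume "2 * s = u + v"
    then show False
    proof (cases rule: even_sum_cases)
      case (1 p q)
      then show False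
        using uv irred[of p q] by (auto simp: T_even)
    next
      case (2 p q)
      then have "p \<in> I" "q \<in> I"
        using uv by (auto simp: T_odd)
      then have pq: "p \<in> S" "q \<in> S" "0 \<le> p" "0 \<le> q"
        using I_subset_S nonneg by auto
      then have "p + q = 0"
        using irred[of "p + q" b] b_mem b_pos 2(3) add by auto
      then have "0 \<in> I"
        using \<open>p \<in> I\<close> pq by (metis add_nonneg_eq_0_iff)
      moreover have "F \<in> B"
        using B_add[OF s(3) S_subset_B[OF s(1)]] by simp
      ultimately show False
        by (simp add: mem_I)
    qed
  qed
  then show "2 * s \<in> minimal_generators T"
    using s by (simp add: T.minimal_generators_iff T_even)
qed

text \<open>
  Translation by \<open>2f\<close> must preserve the odd part of \<open>T\<close>, that is \<open>f + I \<subseteq> I\<close>, and reflection turns this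
  into \<open>f + B \<subseteq> B\<close>, that is \<open>f \<in> B\<close>.
\<close>

lemma T_PF: "2 * f \<in> PF T \<longleftrightarrow> f \<in> PF S \<and> f \<in> B"
proof
  assume "2 * f \<in> PF T"
  then have f: "2 * f \<notin> T" "\<And>m. m \<in> T \<Longrightarrow> m \<noteq> 0 \<Longrightarrow> 2 * f + m \<in> T"
    by (auto simp: T.PF_iff)
  have "f + m \<in> S" if "m \<in> S" "m \<noteq> 0" for m
    using f(2)[of "2 * m"] that T_even[of "f + m"] by (simp add: T_even)
  then have "f \<in> PF S"
    using f(1) by (simp add: PF_iff T_even)
  moreover have "f \<in> B"
  proof (rule ccontr)
    assume "f \<notin> B"
    then have "2 * (F - f) + b \<in> T"
      unfolding T_odd by (simp add: mem_I)
    moreover have "2 * (F - f) + b \<noteq> 0"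
      using b_odd by presburger
    ultimately have "2 * f + (2 * (F - f) + b) \<in> T"
      by (rule f(2))
    then show False
      using F_notin_I T_odd[of F] by (simp add: algebra_simps)
  qed
  ultimately show "f \<in> PF S \<and> f \<in> B" ..
next
  assume f: "f \<in> PF S \<and> f \<in> B"
  have "2 * f + x \<in> T" if x: "x \<in> T" "x \<noteq> 0" for x
  proof -
    consider m where "x = 2 * m" | i where "x = 2 * i + b"
      using parity by blast
    then show ?thesis
    proof cases
      case 1
      then show ?thesis
        using f x T_even[of "f + m"] by (simp add: T_even PF_iff)
    next
      case 2
      have "f + i \<in> I"
        using B_add[of f "F - (f + i)"] f x 2 T_odd[of i] by (auto simp: mem_I)
      then show ?thesis
        using T_odd[of "f + i"] 2 by (simp add: algebra_simps)
    qed
  qed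
  then show "2 * f \<in> PF T"
    using f by (simp add: T.PF_iff PF_iff T_even)
qed

text \<open>
  The difference is in \<open>K\<close> unless it equals \<open>F\<close>, and the latter would make \<open>F - s = - t\<close> a negative
  element of \<open>B\<close>.
\<close>

lemma PF_diff_mem_B:
  assumes st: "s - t \<in> PF S" "t \<in> S" "t \<noteq> 0" "F - s \<in> B"
  shows "s - t \<in> B"
proof -
  have "s - t + 0 \<noteq> F"
    using st B_nonneg[of "F - s"] nonneg[of t] by auto
  then show ?thesis
    using PF_add_K[OF st(1) zero_K] K_subset_B by simp
qed

text \<open>
  An odd \<open>x = 2i + b\<close> has the even reflection \<open>2(F - i)\<close>, which is in \<open>2K(T)\<close> only if \<open>F - i \<in> B\<close>; this is
  precisely what \<open>i \<in> I\<close> excludes. So only doubles of elements of \<open>S\<close> enter the condition for \<open>T\<close>.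
\<close>

lemma T_reflection_in_2K: "x \<in> T - {0} \<and> T.F - x \<in> T.K + T.K \<longleftrightarrow>
    (\<exists>s\<in>S - {0}. F - s \<in> B \<and> x = 2 * s)"
proof -
  consider s where "x = 2 * s" | i where "x = 2 * i + b"
    using parity by blast
  then show ?thesis
  proof cases
    case 1
    have "T.F - x = 2 * (F - s) + b"
      by (simp add: 1 T_frobenius)
    then have "T.F - x \<in> T.K + T.K \<longleftrightarrow> F - s \<in> B"
      by (simp only: T_2K_odd)
    then show ?thesis
      using 1 T_even[of s] by auto
  next
    case 2
    have "T.F - x = 2 * (F - i)"
      by (simp add: 2 T_frobenius)
    then have "F - i \<in> B" if "T.F - x \<in> T.K + T.K"
      using that by (intro T_2K_even) simp
    then have "\<not> (x \<in> T - {0} \<and> T.F - x \<in> T.K + T.K)"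
      by (auto simp: 2 T_odd mem_I)
    moreover have "x \<noteq> 2 * s" for s
      using 2 b_odd by presburger
    then have "\<not> (\<exists>s\<in>S - {0}. F - s \<in> B \<and> x = 2 * s)"
      by simp
    ultimately show ?thesis
      by (simp only:)
  qed
qed

lemma GAS_T_iff: "GAS T \<longleftrightarrow> GAS S"
proof -
  define D where "D = {s \<in> S - {0}. F - s \<in> B}"
  have D_T: "{x \<in> T - {0}. T.F - x \<in> T.K + T.K} = (*) 2 ` D"
    by (rule set_eqI) (simp only: mem_Collect_eq T_reflection_in_2K, auto simp: D_def)
  have PF_D: "2 * s - 2 * t \<in> PF T \<longleftrightarrow> s - t \<in> PF S" if "s \<in> D" "t \<in> D" for s t
    using T_PF[of "s - t"] PF_diff_mem_B[of s t] that by (auto simp: D_def right_diff_distrib)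
  have "gas_on T (T.K + T.K) \<longleftrightarrow>
      (\<forall>x\<in>(*) 2 ` D. x \<in> minimal_generators T \<and> (\<forall>y\<in>(*) 2 ` D. x - y \<notin> PF T))"
    unfolding D_T[symmetric] gas_on_def by auto
  also have "\<dots> \<longleftrightarrow> (\<forall>s\<in>D. s \<in> minimal_generators S \<and> (\<forall>t\<in>D. s - t \<notin> PF S))"
    using T_minimal_generators PF_D by (simp add: D_def)
  also have "\<dots> \<longleftrightarrow> gas_on S B"
    unfolding D_def gas_on_def by auto
  finally show ?thesis
    by (simp add: T.GAS_iff GAS_iff gas_on_B_iff)
qed

end

theorem theorem4p7:
  fixes S I T :: "int set" and b :: int
  assumes "numerical_semigroup S" and "S \<noteq> \<nat>"
    and "b \<in> S" and "odd b"
    and "I = colon S (generated (canonical_ideal S))"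
    and "T = numerical_duplication S b I"
  shows "GAS T \<longleftrightarrow> GAS S"
proof -
  interpret duplication S b
    using assms(1,3,4) by unfold_locales
  show ?thesis
    using GAS_T_iff assms(5,6) by simp
qed

end
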